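(* Let $G_0\in\mathcal{L}_n$ and let $m^{\mathcal{S}}[G_0]$ be the monomial corresponding to it. Then for any reduced form $P_n^{\mathcal{S}}$ of $m^{\mathcal{S}}[G_0]$, the value $P_n^{\mathcal{S}}(x_{ij}=y_{ij}=z_i=1,\ \beta=0)$ is independent of the order of reductions performed; i.e. any two reduced forms of $m^{\mathcal{S}}[G_0]$ take the same value when all variables $x_{ij},y_{ij},z_i$ are set to $1$ and $\beta$ is set to $0$.
   Context: A signed graph $G$ on $[n]=\{1,\dots,n\}$ is a finite multigraph (loops allowed) with each edge labeled $+$ or $-$; all loops are labeled $+$. An edge with endpoints $i,j$ and sign $\epsilon$ is written $(i,j,\epsilon)=(j,i,\epsilon)$. Let $e_1,\dots,e_n$ be the standard basis of $\mathbb{R}^n$. For $i\le j$ put $\mathrm{v}(i,j,-)=e_i-e_j$ (here $i<j$) and $\mathrm{v}(i,j,+)=e_i+e_j$ (so $\mathrm{v}(i,i,+)=2e_i$). $\mathcal{L}_n$ is the set of signed graphs $G$ on $[n]$ for which the vectors $\mathrm{v}(e)$, $e\in E(G)$, are linearly independent. To a signed graph $G$ associate the commutative monomial $m^{\mathcal{S}}[G]=\prod_{e\in E(G)}\mathrm{w}(e)$, where, for $i<j$, $\mathrm{w}(i,j,-)=x_{ij}$, $\mathrm{w}(i,j,+)=y_{ij}$, and $\mathrm{w}(i,i,+)=z_i$. Reduced forms: all variables $x_{ij},y_{ij}$ $(1\le i<j\le n)$, $z_k$ $(k\in[n])$ and $\beta$ commute. The reduction rules (replace the product of two variables on the left, occurring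 in a monomial, by the right-hand side) are, for $1\le i<j<k\le n$ in the first four and $1\le i<j\le n$ in the last two: $x_{ij}x_{jk}\to x_{ik}x_{ij}+x_{jk}x_{ik}+\beta x_{ik}$; $x_{ij}y_{jk}\to y_{ik}x_{ij}+y_{jk}y_{ik}+\beta y_{ik}$; $x_{ik}y_{jk}\to y_{jk}y_{ij}+y_{ij}x_{ik}+\beta y_{ij}$; $y_{ik}x_{jk}\to x_{jk}y_{ij}+y_{ij}y_{ik}+\beta y_{ij}$; $y_{ij}x_{ij}\to z_ix_{ij}+y_{ij}z_i+\beta z_i$; $x_{ij}z_j\to y_{ij}x_{ij}+z_jy_{ij}+\beta y_{ij}$. A reduced form $P_n^{\mathcal{S}}$ of a monomial is a polynomial obtained from it by successive applications of these rules (to monomials of the current polynomial, in any order) until no further reduction is possible. *)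

theory Defs
  imports Complex_Main "HOL-Library.Poly_Mapping"
begin

section \<open>Signed graphs\<close>

datatype sign = Plus | Minus

text \<open>
  An unordered signed edge is stored as a triple \<open>(i, j, s)\<close> with \<open>i \<le> j\<close>.  Since graphs may
  have parallel edges, edges are abstract objects, and \<open>label\<close> gives the endpoints and sign.
\<close>

type_synonym signed_edge = "nat \<times> nat \<times> sign"

record 'e signed_graph =
  edges :: "'e set"
  label :: "'e \<Rightarrow> signed_edge"

fun valid_edge :: "nat \<Rightarrow> signed_edge \<Rightarrow> bool" where
  "valid_edge n (i, j, s) \<longleftrightarrow> 1 \<le> i \<and> i \<le> j \<and> j \<le> n \<and> (i = j \<longrightarrow> s = Plus)"

definition is_signed_graph :: "nat \<Rightarrow> 'e signed_graph \<Rightarrow> bool" where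
  "is_signed_graph n G \<longleftrightarrow> finite (edges G) \<and> (\<forall>e\<in>edges G. valid_edge n (label G e))"

text \<open>Vectors of \<open>\<real>\<^sup>n\<close> are functions on \<open>nat\<close>, of which only the coordinates in \<open>{1..n}\<close> matter.\<close>

definition std_basis :: "nat \<Rightarrow> nat \<Rightarrow> real" where
  "std_basis i = (\<lambda>k. if k = i then 1 else 0)"

fun edge_vec :: "signed_edge \<Rightarrow> nat \<Rightarrow> real" where
  "edge_vec (i, j, Minus) = (\<lambda>k. std_basis i k - std_basis j k)"
| "edge_vec (i, j, Plus) = (\<lambda>k. std_basis i k + std_basis j k)"

text \<open>Linear independence of a finite family of vectors of \<open>\<real>\<^sup>n\<close>; repeated vectors are dependent.\<close>

definition lin_indep_family :: "nat \<Rightarrow> 'e set \<Rightarrow> ('e \<Rightarrow> nat \<Rightarrow> real) \<Rightarrow> bool" where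
  "lin_indep_family n E v \<longleftrightarrow>
     (\<forall>c :: 'e \<Rightarrow> real. (\<forall>k\<in>{1..n}. (\<Sum>e\<in>E. c e * v e k) = 0) \<longrightarrow> (\<forall>e\<in>E. c e = 0))"

definition indep_signed_graphs :: "nat \<Rightarrow> 'e signed_graph set" where
  "indep_signed_graphs n =
     {G. is_signed_graph n G \<and> lin_indep_family n (edges G) (\<lambda>e. edge_vec (label G e))}"

section \<open>Polynomials in the variables \<open>x\<^sub>i\<^sub>j, y\<^sub>i\<^sub>j, z\<^sub>i, \<beta>\<close>\<close>

datatype svar = X nat nat | Y nat nat | Z nat | Beta

text \<open>
  Monomials are exponent vectors, and polynomials are finitely supported maps from monomials to
  integer coefficients; addition and multiplication are those of \<open>Poly_Mapping\<close>.
\<close>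

type_synonym smonom = "svar \<Rightarrow>\<^sub>0 nat"
type_synonym spoly = "smonom \<Rightarrow>\<^sub>0 int"

definition monom_of :: "svar \<Rightarrow> smonom" where
  "monom_of v = Poly_Mapping.single v 1"

definition var :: "svar \<Rightarrow> spoly" where
  "var v = Poly_Mapping.single (monom_of v) 1"

definition eval_spoly :: "(svar \<Rightarrow> int) \<Rightarrow> spoly \<Rightarrow> int" where
  "eval_spoly a p = (\<Sum>m\<in>Poly_Mapping.keys p. Poly_Mapping.lookup p m *
     (\<Prod>v\<in>Poly_Mapping.keys m. a v ^ Poly_Mapping.lookup m v))"

fun edge_var :: "signed_edge \<Rightarrow> svar" where
  "edge_var (i, j, Minus) = X i j"
| "edge_var (i, j, Plus) = (if i = j then Z i else Y i j)"

definition graph_monomial :: "'e signed_graph \<Rightarrow> spoly" where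
  "graph_monomial G = (\<Prod>e\<in>edges G. var (edge_var (label G e)))"

section \<open>Reductions\<close>

text \<open>\<open>reduction_rule n u v r\<close>: the product of the variables \<open>u\<close> and \<open>v\<close> may be replaced by \<open>r\<close>.\<close>

inductive reduction_rule :: "nat \<Rightarrow> svar \<Rightarrow> svar \<Rightarrow> spoly \<Rightarrow> bool" for n :: nat where
  "\<lbrakk>1 \<le> i; i < j; j < k; k \<le> n\<rbrakk> \<Longrightarrow> reduction_rule n (X i j) (X j k)
     (var (X i k) * var (X i j) + var (X j k) * var (X i k) + var Beta * var (X i k))"
| "\<lbrakk>1 \<le> i; i < j; j < k; k \<le> n\<rbrakk> \<Longrightarrow> reduction_rule n (X i j) (Y j k)
     (var (Y i k) * var (X i j) + var (Y j k) * var (Y i k) + var Beta * var (Y i k))"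
| "\<lbrakk>1 \<le> i; i < j; j < k; k \<le> n\<rbrakk> \<Longrightarrow> reduction_rule n (X i k) (Y j k)
     (var (Y j k) * var (Y i j) + var (Y i j) * var (X i k) + var Beta * var (Y i j))"
| "\<lbrakk>1 \<le> i; i < j; j < k; k \<le> n\<rbrakk> \<Longrightarrow> reduction_rule n (Y i k) (X j k)
     (var (X j k) * var (Y i j) + var (Y i j) * var (Y i k) + var Beta * var (Y i j))"
| "\<lbrakk>1 \<le> i; i < j; j \<le> n\<rbrakk> \<Longrightarrow> reduction_rule n (Y i j) (X i j)
     (var (Z i) * var (X i j) + var (Y i j) * var (Z i) + var Beta * var (Z i))"
| "\<lbrakk>1 \<le> i; i < j; j \<le> n\<rbrakk> \<Longrightarrow> reduction_rule n (X i j) (Z j)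
     (var (Y i j) * var (X i j) + var (Z j) * var (Y i j) + var Beta * var (Y i j))"

text \<open>
  One step rewrites a single occurrence of a monomial of \<open>p\<close>.  A monomial with coefficient \<open>c\<close>
  counts as \<open>c\<close> occurrences, which may be reduced in different ways; reducing the whole term at
  once amounts to \<open>c\<close> equal steps.  (All polynomials reachable from a monomial have nonnegative
  coefficients.)
\<close>

inductive reduction_step :: "nat \<Rightarrow> spoly \<Rightarrow> spoly \<Rightarrow> bool" for n :: nat where
  "\<lbrakk>reduction_rule n u v r; monom_of u + monom_of v + m \<in> Poly_Mapping.keys p\<rbrakk> \<Longrightarrow>
     reduction_step n p
       (p - Poly_Mapping.single (monom_of u + monom_of v + m) 1 + r * Poly_Mapping.single m 1)"

definition reduced_form :: "nat \<Rightarrow> spoly \<Rightarrow> spoly \<Rightarrow> bool" where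
  "reduced_form n p q \<longleftrightarrow> (reduction_step n)\<^sup>*\<^sup>* p q \<and> (\<nexists>q'. reduction_step n q q')"

definition ones_beta_zero :: "svar \<Rightarrow> int" where
  "ones_beta_zero v = (if v = Beta then 0 else 1)"

end

theory Submission
  imports Defs "HOL-Analysis.Equivalence_Lebesgue_Henstock_Integration"
begin

text \<open>
  Attach to each variable the root it stands for.  With \<open>\<beta> = 0\<close> every rule replaces a product \<open>u v\<close> by
  \<open>w u + w v\<close>, where the root of \<open>w\<close> is the sum of the roots of \<open>u\<close> and \<open>v\<close>.  The quadrant
  \<open>{s u + t v | s, t \<ge> 0}\<close> is cut by the ray through \<open>w\<close> into two parametrised quadrants, with
  Jacobian 1, so the integral of \<open>exp (- \<parallel>t\<^sub>1 v\<^sub>1 + \<dots> + t\<^sub>d v\<^sub>d\<parallel>\<^sub>1 / 2)\<close> over \<open>t\<^sub>1, \<dots>, t\<^sub>d \<ge> 0\<close>,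
  extended linearly from monomials to polynomials, is invariant under reduction.  A rule applies to
  \<open>u v\<close> exactly when their roots have opposite signs in some coordinate.  Hence for an irreducible
  monomial the 1-norm is linear on the cone; since every root has 1-norm 2, the integral is
  that of \<open>exp (- t\<^sub>1 - \<dots> - t\<^sub>d)\<close>, which is 1.  So the integral of the initial monomial is the value at
  1 of each of its reduced forms.
\<close>

section \<open>Integration along rays\<close>

text \<open>All of \<open>nat\<close> serves as index set, so every function of type
  \<open>nat \<Rightarrow> real\<close> is a point of the space and no extensionality condition
  arises.\<close>

abbreviation seq_space :: "(nat \<Rightarrow> real) measure" where
  "seq_space \<equiv> Pi\<^sub>M UNIV (\<lambda>_. borel)"

text \<open>Iterated over a list of generators, this integrates \<open>f\<close> over the
  parametrised cone with apex \<open>x\<close>. Values in \<open>ennreal\<close> avoid integrability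
  conditions.\<close>

definition ray_integral ::
  "(nat \<Rightarrow> real) \<Rightarrow> ((nat \<Rightarrow> real) \<Rightarrow> ennreal) \<Rightarrow> (nat \<Rightarrow> real) \<Rightarrow> ennreal" where
  "ray_integral v f x = (\<integral>\<^sup>+t. f (\<lambda>k. x k + t * v k) * indicator {0..} t \<partial>lborel)"

lemma measurable_seq_space_iff:
  "g \<in> measurable M seq_space \<longleftrightarrow> (\<forall>k. (\<lambda>x. g x k) \<in> borel_measurable M)"
proof
  assume "g \<in> measurable M seq_space"
  then show "\<forall>k. (\<lambda>x. g x k) \<in> borel_measurable M"
    by (auto intro: measurable_compose[OF _ measurable_component_singleton])
next
  assume "\<forall>k. (\<lambda>x. g x k) \<in> borel_measurable M"
  then show "g \<in> measurable M seq_space"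
    by (intro measurable_PiM_single') (auto simp: PiE_def)
qed

lemma measurable_ray_point:
  assumes f: "f \<in> borel_measurable seq_space"
    and "g \<in> measurable M seq_space" "h \<in> borel_measurable M"
  shows "(\<lambda>y. f (\<lambda>k. g y k + h y * v k)) \<in> borel_measurable M"
proof (rule measurable_compose[OF _ f])
  show "(\<lambda>y k. g y k + h y * v k) \<in> measurable M seq_space"
    using assms(2,3) unfolding measurable_seq_space_iff
    by (auto intro!: borel_measurable_add borel_measurable_times)
qed

lemma ray_integral_measurable [measurable]:
  assumes "f \<in> borel_measurable seq_space"
  shows "ray_integral v f \<in> borel_measurable seq_space"
proof -
  have [measurable]: "(\<lambda>y. f (\<lambda>k. fst y k + snd y * v k)) \<in> borel_measurable (seq_space \<Otimes>\<^sub>M lborel)"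
    by (rule measurable_ray_point[OF assms]) auto
  have "(\<lambda>x. \<integral>\<^sup>+t. f (\<lambda>k. x k + t * v k) * indicator {0..} t \<partial>lborel) \<in> borel_measurable seq_space"
    by (rule lborel.borel_measurable_nn_integral) (simp add: case_prod_unfold)
  then show ?thesis
    by (simp add: ray_integral_def[abs_def])
qed

lemma ray_integral_pair:
  assumes "f \<in> borel_measurable seq_space"
  shows "ray_integral u (ray_integral v f) x =
    (\<integral>\<^sup>+s. \<integral>\<^sup>+t. f (\<lambda>k. x k + s * u k + t * v k) * indicator {0..} t * indicator {0..} s
       \<partial>lborel \<partial>lborel)"
proof -
  have meas: "(\<lambda>t. f (\<lambda>k. (x k + s * u k) + t * v k)) \<in> borel_measurable borel" for s
    by (rule measurable_ray_point[OF assms]) (auto simp: measurable_seq_space_iff)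
  show ?thesis
    unfolding ray_integral_def
    by (rule nn_integral_cong, rule nn_integral_multc[symmetric]) (use meas in auto)
qed

lemma measurable_plane:
  assumes "f \<in> borel_measurable seq_space"
  shows "(\<lambda>(s, t). f (\<lambda>k. x k + s * u k + t * v k)) \<in> borel_measurable (borel \<Otimes>\<^sub>M borel)"
  unfolding case_prod_unfold
  by (rule measurable_ray_point[OF assms]) (auto simp: measurable_seq_space_iff)

text \<open>Tonelli. The order of the generators is irrelevant, so cones can be indexed by
  multisets.\<close>

lemma ray_integral_commute:
  assumes f: "f \<in> borel_measurable seq_space"
  shows "ray_integral u (ray_integral v f) = ray_integral v (ray_integral u f)"
proof
  fix x
  note [measurable] = measurable_plane[OF f, of x v u]
  have "ray_integral v (ray_integral u f) x =
    (\<integral>\<^sup>+s. \<integral>\<^sup>+t. f (\<lambda>k. x k + t * v k + s * u k) * indicator {0..} s * indicator {0..} t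
       \<partial>lborel \<partial>lborel)"
    unfolding ray_integral_pair[OF f] by (rule lborel_pair.Fubini') measurable
  also have "\<dots> = ray_integral u (ray_integral v f) x"
    unfolding ray_integral_pair[OF f] by (simp add: algebra_simps)
  finally show "ray_integral u (ray_integral v f) x = ray_integral v (ray_integral u f) x" ..
qed

lemma nn_integral_lborel_shift:
  assumes "h \<in> borel_measurable borel"
  shows "(\<integral>\<^sup>+t. h t \<partial>lborel) = (\<integral>\<^sup>+t. h (s + t :: real) \<partial>lborel)"
  using nn_integral_real_affine[OF assms, of 1 s] by simp

text \<open>Cut the parameter quadrant along its diagonal. Where t \<le> s, put s = t + r, so that s
  u + t v = r u + t w; where t > s, put t = s + r, which gives s w + r v. Both substitutions are
  translations in one variable.\<close>

lemma ray_integral_split: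
  assumes f: "f \<in> borel_measurable seq_space" and w: "w = (\<lambda>k. u k + v k)"
  shows "ray_integral u (ray_integral v f) x =
    ray_integral u (ray_integral w f) x + ray_integral v (ray_integral w f) x"
proof -
  define g where "g s t = f (\<lambda>k. x k + s * u k + t * v k)" for s t
  have g [measurable]: "case_prod g \<in> borel_measurable (borel \<Otimes>\<^sub>M borel)"
    using measurable_plane[OF f, of x u v] by (simp add: g_def[abs_def])
  have [measurable]: "(\<lambda>s. g s t) \<in> borel_measurable borel" 
    "(\<lambda>t. g s t) \<in> borel_measurable borel" for s t
    by measurable
  have below: "(\<integral>\<^sup>+s. \<integral>\<^sup>+t. g s t * indicator {0..s} t \<partial>lborel \<partial>lborel) =
      ray_integral w (ray_integral u f) x"
  proof -
    have "(\<integral>\<^sup>+s. \<integral>\<^sup>+t. g s t * indicator {0..s} t \<partial>lborel \<partial>lborel) =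
        (\<integral>\<^sup>+s. \<integral>\<^sup>+t. g s t * indicator {0..} t * indicator {0..} (s - t) \<partial>lborel \<partial>lborel)"
      by (intro nn_integral_cong) (auto simp: indicator_def)
    \<comment> \<open>The variable to be translated here is \<open>s\<close>, so it has to become
      the inner one; in \<open>above\<close> it is \<open>t\<close>, which is inner already.\<close>
    also have "\<dots> = (\<integral>\<^sup>+t. \<integral>\<^sup>+s. g s t * indicator {0..} t * indicator {0..} (s - t) \<partial>lborel \<partial>lborel)"
      by (rule lborel_pair.Fubini') measurable
    also have "\<dots> = (\<integral>\<^sup>+t. \<integral>\<^sup>+r. g (t + r) t * indicator {0..} t * indicator {0..} r \<partial>lborel \<partial>lborel)"
    proof (rule nn_integral_cong)
      fix t :: real
      have "(\<lambda>s. g s t * indicator {0..} t * indicator {0..} (s - t)) \<in> borel_measurable borel"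
        by measurable
      from nn_integral_lborel_shift[OF this, of t]
      show "(\<integral>\<^sup>+s. g s t * indicator {0..} t * indicator {0..} (s - t) \<partial>lborel) =
        (\<integral>\<^sup>+r. g (t + r) t * indicator {0..} t * indicator {0..} r \<partial>lborel)" by simp
    qed
    finally show ?thesis
      by (simp add: ray_integral_pair[OF f] g_def w algebra_simps)
  qed
  have above: "(\<integral>\<^sup>+s. \<integral>\<^sup>+t. g s t * indicator {0..} s * indicator {0<..} (t - s) \<partial>lborel \<partial>lborel) =
      ray_integral w (ray_integral v f) x"
  proof -
    have "(\<integral>\<^sup>+s. \<integral>\<^sup>+t. g s t * indicator {0..} s * indicator {0<..} (t - s) \<partial>lborel \<partial>lborel) =
        (\<integral>\<^sup>+s. \<integral>\<^sup>+r. g s (s + r) * indicator {0..} r * indicator {0..} s \<partial>lborel \<partial>lborel)"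
    proof (rule nn_integral_cong)
      fix s :: real
      have "(\<lambda>t. g s t * indicator {0..} s * indicator {0<..} (t - s)) \<in> borel_measurable borel"
        by measurable
      from nn_integral_lborel_shift[OF this, of s]
      have "(\<integral>\<^sup>+t. g s t * indicator {0..} s * indicator {0<..} (t - s) \<partial>lborel) =
        (\<integral>\<^sup>+r. g s (s + r) * indicator {0..} s * indicator {0<..} r \<partial>lborel)" by simp
      \<comment> \<open>The diagonal was counted in \<open>below\<close>; adding it here again
        changes the inner integral only at r = 0, a null set.\<close>
      also have "\<dots> = (\<integral>\<^sup>+r. g s (s + r) * indicator {0..} r * indicator {0..} s \<partial>lborel)"
        by (intro nn_integral_cong_AE, rule AE_mp[OF AE_lborel_singleton[of 0]])
          (auto simp: indicator_def)
      finally show "(\<integral>\<^sup>+t. g s t * indicator {0..} s * indicator {0<..} (t - s) \<partial>lborel) = \<dots>" .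
    qed
    then show ?thesis
      by (simp add: ray_integral_pair[OF f] g_def w algebra_simps)
  qed
  have "ray_integral u (ray_integral v f) x =
    (\<integral>\<^sup>+s. \<integral>\<^sup>+t. (g s t * indicator {0..s} t + g s t * indicator {0..} s * indicator {0<..} (t - s))
       \<partial>lborel \<partial>lborel)"
    unfolding ray_integral_pair[OF f] g_def
    by (intro nn_integral_cong) (auto simp: indicator_def)
  also have "\<dots> = (\<integral>\<^sup>+s. (\<integral>\<^sup>+t. g s t * indicator {0..} t * indicator {0..} (s - t) \<partial>lborel) +
      (\<integral>\<^sup>+t. g s t * indicator {0..} s * indicator {0<..} (t - s) \<partial>lborel) \<partial>lborel)"
    by (subst nn_integral_add[symmetric]) (auto intro!: nn_integral_cong simp: indicator_def)
  also have "\<dots> = (\<integral>\<^sup>+s. \<integral>\<^sup>+t. g s t * indicator {0..} t * indicator {0..} (s - t) \<partial>lborel \<partial>lborel) +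
      (\<integral>\<^sup>+s. \<integral>\<^sup>+t. g s t * indicator {0..} s * indicator {0<..} (t - s) \<partial>lborel \<partial>lborel)"
    by (rule nn_integral_add) measurable
  also have "(\<integral>\<^sup>+s. \<integral>\<^sup>+t. g s t * indicator {0..} t * indicator {0..} (s - t) \<partial>lborel \<partial>lborel) =
      (\<integral>\<^sup>+s. \<integral>\<^sup>+t. g s t * indicator {0..s} t \<partial>lborel \<partial>lborel)"
    by (intro nn_integral_cong) (auto simp: indicator_def)
  finally show ?thesis
    unfolding below above by (simp add: ray_integral_commute[OF f])
qed


section \<open>Weights of monomials\<close>

text \<open>The value at \<open>Beta\<close> is a placeholder: \<open>monom_weight\<close> vanishes
  on every monomial that contains \<open>Beta\<close>.\<close>

fun root_of :: "svar \<Rightarrow> nat \<Rightarrow> real" where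
  "root_of (X i j) = edge_vec (i, j, Minus)"
| "root_of (Y i j) = edge_vec (i, j, Plus)"
| "root_of (Z i) = edge_vec (i, i, Plus)"
| "root_of Beta = (\<lambda>_. 0)"

fun valid_var :: "nat \<Rightarrow> svar \<Rightarrow> bool" where
  "valid_var n (X i j) \<longleftrightarrow> 1 \<le> i \<and> i < j \<and> j \<le> n"
| "valid_var n (Y i j) \<longleftrightarrow> 1 \<le> i \<and> i < j \<and> j \<le> n"
| "valid_var n (Z i) \<longleftrightarrow> 1 \<le> i \<and> i \<le> n"
| "valid_var n Beta \<longleftrightarrow> True"

text \<open>The division by 2 compensates the 1-norm of the roots (\<open>root_norm\<close>): where
  no coordinates cancel, moving by t along a root multiplies the density by
  \<open>exp (- t)\<close>.\<close>

definition base_density :: "nat \<Rightarrow> (nat \<Rightarrow> real) \<Rightarrow> ennreal" where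
  "base_density n x = ennreal (exp (- (\<Sum>k\<in>{1..n}. \<bar>x k\<bar>) / 2))"

text \<open>Outside the measurable functions the operator is the identity, so that the operators commute
  unconditionally and can be folded over a multiset.\<close>

definition ray_op :: "svar \<Rightarrow> ((nat \<Rightarrow> real) \<Rightarrow> ennreal) \<Rightarrow> (nat \<Rightarrow> real) \<Rightarrow> ennreal" where
  "ray_op v f = (if f \<in> borel_measurable seq_space then ray_integral (root_of v) f else f)"

definition cone_integral :: "nat \<Rightarrow> svar multiset \<Rightarrow> (nat \<Rightarrow> real) \<Rightarrow> ennreal" where
  "cone_integral n M = fold_mset ray_op (base_density n) M"

definition vars_of :: "smonom \<Rightarrow> svar multiset" where
  "vars_of m = Abs_multiset (Poly_Mapping.lookup m)"

text \<open>The value 0 in the first case encodes the specialisation \<beta> = 0.\<close>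

definition monom_weight :: "nat \<Rightarrow> smonom \<Rightarrow> ennreal" where
  "monom_weight n m =
     (if Beta \<in> Poly_Mapping.keys m then 0 else cone_integral n (vars_of m) (\<lambda>_. 0))"

definition poly_weight :: "nat \<Rightarrow> spoly \<Rightarrow> ennreal" where
  "poly_weight n p = (\<Sum>m\<in>Poly_Mapping.keys p.
     ennreal (of_int (Poly_Mapping.lookup p m)) * monom_weight n m)"

interpretation ray_op: comp_fun_commute ray_op
  by standard (auto simp: ray_op_def fun_eq_iff ray_integral_commute)

lemma base_density_measurable: "base_density n \<in> borel_measurable seq_space"
  unfolding base_density_def[abs_def] by measurable

lemma cone_integral_measurable: "cone_integral n M \<in> borel_measurable seq_space"
  by (induction M) (auto simp: cone_integral_def base_density_measurable ray_op_def)

lemma cone_integral_add_mset: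
  "cone_integral n (add_mset v M) = ray_integral (root_of v) (cone_integral n M)"
  using cone_integral_measurable[of n M] by (simp add: cone_integral_def ray_op_def)

lemma cone_integral_split:
  assumes "root_of w = (\<lambda>k. root_of u k + root_of v k)"
  shows "cone_integral n (add_mset u (add_mset v M)) x =
    cone_integral n (add_mset u (add_mset w M)) x + cone_integral n (add_mset v (add_mset w M)) x"
  unfolding cone_integral_add_mset
  by (rule ray_integral_split[OF cone_integral_measurable assms])

lemma count_vars_of [simp]: "count (vars_of m) = Poly_Mapping.lookup m"
proof -
  have "{v. 0 < Poly_Mapping.lookup m v} = Poly_Mapping.keys m"
    by (auto simp: in_keys_iff)
  then show ?thesis
    by (simp add: vars_of_def count_Abs_multiset)
qed

lemma set_vars_of [simp]: "set_mset (vars_of m) = Poly_Mapping.keys m"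
  by (auto simp: set_mset_def in_keys_iff)

lemma vars_of_add: "vars_of (m + m') = vars_of m + vars_of m'"
  by (rule multiset_eqI) (simp add: lookup_add)

lemma vars_of_monom_of: "vars_of (monom_of v) = {#v#}"
  by (rule multiset_eqI) (simp add: monom_of_def lookup_single when_def)

lemma keys_monom_add:
  "Poly_Mapping.keys (m + m' :: smonom) = Poly_Mapping.keys m \<union> Poly_Mapping.keys m'"
  by (simp flip: set_vars_of add: vars_of_add)

lemma keys_monom_of: "Poly_Mapping.keys (monom_of v) = {v}"
  by (simp flip: set_vars_of add: vars_of_monom_of)

lemma monom_weight_split:
  assumes "root_of w = (\<lambda>k. root_of u k + root_of v k)" "u \<noteq> Beta" "v \<noteq> Beta" "w \<noteq> Beta"
  shows "monom_weight n (monom_of u + monom_of v + m) =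
    monom_weight n (monom_of w + monom_of u + m) + monom_weight n (monom_of w + monom_of v + m)"
  using assms(2-) cone_integral_split[OF assms(1), of n "vars_of m" "\<lambda>_. 0"]
  by (simp add: monom_weight_def keys_monom_add keys_monom_of vars_of_add vars_of_monom_of
      add_mset_commute)

section \<open>Irreducible monomials\<close>

lemma sum_std_basis: "1 \<le> i \<Longrightarrow> i \<le> n \<Longrightarrow> (\<Sum>k\<in>{1..n}. std_basis i k) = 1"
  by (simp add: std_basis_def)

lemma root_norm:
  assumes "valid_var n v" "v \<noteq> Beta"
  shows "(\<Sum>k\<in>{1..n}. \<bar>root_of v k\<bar>) = 2"
proof -
  obtain i j where ij: "1 \<le> i" "i \<le> n" "1 \<le> j" "j \<le> n"
      and "\<And>k. \<bar>root_of v k\<bar> = std_basis i k + std_basis j k"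
    using assms
  proof (cases v)
    case (X i j)
    with assms that[of i j] show ?thesis by (auto simp: std_basis_def)
  next
    case (Y i j)
    with assms that[of i j] show ?thesis by (auto simp: std_basis_def)
  next
    case (Z i)
    with assms that[of i i] show ?thesis by (auto simp: std_basis_def)
  qed auto
  then show ?thesis
    by (simp only: sum.distrib sum_std_basis)
qed

lemma nn_integral_exp_neg: "(\<integral>\<^sup>+t. ennreal (exp (- t)) * indicator {0..} t \<partial>lborel) = 1"
proof -
  have "(\<integral>\<^sup>+t. ennreal (exp (- t)) * indicator {0..} t \<partial>lborel) = ennreal (0 - - exp (- 0))"
  proof (rule nn_integral_FTC_atLeast)
    show "((\<lambda>t::real. - exp (- t)) \<longlongrightarrow> 0) at_top"
      using tendsto_minus[OF filterlim_compose[OF exp_at_bot filterlim_uminus_at_bot_at_top]] by simp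
  qed (auto intro!: derivative_eq_intros)
  then show ?thesis by simp
qed

text \<open>The sign vector \<open>\<sigma>\<close> fixes a closed orthant containing
  \<open>x\<close> and all the roots. Moving along a root stays in it, so each generator contributes
  a factor \<open>exp (- t)\<close>, whose integral is 1. The induction therefore needs an arbitrary
  apex in the orthant.\<close>

lemma cone_integral_coherent:
  assumes "\<And>k. \<bar>\<sigma> k\<bar> = 1"
    and "\<And>v. v \<in># M \<Longrightarrow> valid_var n v \<and> v \<noteq> Beta"
    and "\<And>v k. v \<in># M \<Longrightarrow> \<sigma> k * root_of v k = \<bar>root_of v k\<bar>"
    and "\<And>k. \<sigma> k * x k = \<bar>x k\<bar>"
  shows "cone_integral n M x = base_density n x"
  using assms(2-)
proof (induction M arbitrary: x)
  case empty
  then show ?case by (simp add: cone_integral_def)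
next
  case (add v M)
  have v: "valid_var n v" "v \<noteq> Beta" "\<And>k. \<sigma> k * root_of v k = \<bar>root_of v k\<bar>"
    using add.prems(1,2) by auto
  have eq: "cone_integral n M (\<lambda>k. x k + t * root_of v k) = base_density n x * ennreal (exp (- t))"
    if "0 \<le> t" for t
  proof -
    have abs: "\<sigma> k * (x k + t * root_of v k) = \<bar>x k\<bar> + t * \<bar>root_of v k\<bar>" for k
      using add.prems(3)[of k] v(3)[of k] by (simp add: algebra_simps)
    have coh: "\<sigma> k * (x k + t * root_of v k) = \<bar>x k + t * root_of v k\<bar>" for k
    proof -
      have "0 \<le> \<sigma> k * (x k + t * root_of v k)"
        unfolding abs using that by simp
      then have "\<sigma> k * (x k + t * root_of v k) = \<bar>\<sigma> k\<bar> * \<bar>x k + t * root_of v k\<bar>"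
        by (simp flip: abs_mult)
      then show ?thesis
        by (simp add: assms(1))
    qed
    have "cone_integral n M (\<lambda>k. x k + t * root_of v k) =
        base_density n (\<lambda>k. x k + t * root_of v k)"
      using add.prems(1,2) coh by (intro add.IH) auto
    also have "\<dots> = ennreal (exp (- (\<Sum>k\<in>{1..n}. \<bar>x k\<bar> + t * \<bar>root_of v k\<bar>) / 2))"
      unfolding base_density_def by (simp flip: coh add: abs)
    also have "(\<Sum>k\<in>{1..n}. \<bar>x k\<bar> + t * \<bar>root_of v k\<bar>) = (\<Sum>k\<in>{1..n}. \<bar>x k\<bar>) + t * 2"
      by (simp only: sum.distrib root_norm[OF v(1,2)] flip: sum_distrib_left)
    also have "ennreal (exp (- ((\<Sum>k\<in>{1..n}. \<bar>x k\<bar>) + t * 2) / 2)) =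
        base_density n x * ennreal (exp (- t))"
      unfolding base_density_def
      by (simp flip: ennreal_mult exp_add add: field_simps)
    finally show ?thesis .
  qed
  have "cone_integral n (add_mset v M) x =
      (\<integral>\<^sup>+t. base_density n x * (ennreal (exp (- t)) * indicator {0..} t) \<partial>lborel)"
    unfolding cone_integral_add_mset ray_integral_def
    by (intro nn_integral_cong) (auto simp: indicator_def eq)
  also have "\<dots> = base_density n x"
    by (subst nn_integral_cmult) (auto simp: nn_integral_exp_neg)
  finally show ?case .
qed

text \<open>A root is negative only at the second index of an \<open>X\<close> variable. The four
  ways for \<open>v\<close> to be positive at \<open>k\<close> then match the left-hand sides of the
  rules; for \<open>Y j k\<close> the order of \<open>i\<close> and \<open>j\<close> selects among
  three of them.\<close>

lemma conflict_reducible: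
  assumes "valid_var n u" "valid_var n v" "root_of u k < 0" "0 < root_of v k"
  shows "\<exists>r. reduction_rule n u v r \<or> reduction_rule n v u r"
proof -
  obtain i where u: "u = X i k" "1 \<le> i" "i < k" "k \<le> n"
    using assms(1,3) by (cases u) (auto simp: std_basis_def split: if_splits)
  consider (X) j where "v = X k j" "k < j" "j \<le> n" | (Y1) j where "v = Y k j" "k < j" "j \<le> n"
    | (Y2) j where "v = Y j k" "1 \<le> j" "j < k" | (Z) "v = Z k"
    using assms(2,4) by (cases v) (auto simp: std_basis_def split: if_splits)
  then show ?thesis
  proof cases
    case X
    with u show ?thesis by (blast intro: reduction_rule.intros)
  next
    case Y1
    with u show ?thesis by (blast intro: reduction_rule.intros)
  next
    case Y2
    consider "i < j" | "j < i" | "i = j" by linarith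
    then show ?thesis
      using Y2 u by cases (blast intro: reduction_rule.intros)+
  next
    case Z
    with u show ?thesis by (blast intro: reduction_rule.intros)
  qed
qed

lemma keys_decompose:
  assumes "u \<in> Poly_Mapping.keys m" "v \<in> Poly_Mapping.keys m" "u \<noteq> v"
  shows "\<exists>m'. m = monom_of u + monom_of v + (m' :: smonom)"
proof
  \<comment> \<open>Truncated subtraction of exponents is exact: \<open>u\<close> and
    \<open>v\<close> are distinct and each has exponent at least 1.\<close>
  show "m = monom_of u + monom_of v + (m - (monom_of u + monom_of v))"
    using assms
    by (intro poly_mapping_eqI)
      (auto simp: lookup_add lookup_minus monom_of_def lookup_single when_def in_keys_iff)
qed

lemma monom_weight_irreducible:
  assumes valid: "\<And>v. v \<in> Poly_Mapping.keys m \<Longrightarrow> valid_var n v"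
    and irred: "\<And>u v r m'. reduction_rule n u v r \<Longrightarrow> m \<noteq> monom_of u + monom_of v + m'"
    and Beta: "Beta \<notin> Poly_Mapping.keys m"
  shows "monom_weight n m = 1"
proof -
  \<comment> \<open>By irreducibility all roots of \<open>m\<close> agree in sign at each
    coordinate; \<open>\<sigma>\<close> records that sign, with 1 where none is negative.\<close>
  define \<sigma> :: "nat \<Rightarrow> real"
    where "\<sigma> k = (if \<exists>u\<in>Poly_Mapping.keys m. root_of u k < 0 then -1 else 1)" for k
  have "\<sigma> k * root_of v k = \<bar>root_of v k\<bar>" if v: "v \<in> Poly_Mapping.keys m" for v k
  proof (cases "\<exists>u\<in>Poly_Mapping.keys m. root_of u k < 0")
    case True
    then obtain u where u: "u \<in> Poly_Mapping.keys m" "root_of u k < 0" by blast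
    have "\<not> 0 < root_of v k"
    proof
      assume pos: "0 < root_of v k"
      \<comment> \<open>\<open>u\<close> and \<open>v\<close> differ because their roots have
        opposite signs at \<open>k\<close>.\<close>
      obtain m' where m': "m = monom_of u + monom_of v + m'"
        using keys_decompose[OF u(1) v] u(2) pos by fastforce
      moreover have "m = monom_of v + monom_of u + m'"
        using m' by (simp add: add_ac)
      ultimately show False
        using conflict_reducible[OF valid[OF u(1)] valid[OF v] u(2) pos] irred by blast
    qed
    with True show ?thesis by (simp add: \<sigma>_def)
  next
    case False
    with v show ?thesis by (force simp: \<sigma>_def)
  qed
  then have "cone_integral n (vars_of m) (\<lambda>_. 0) = base_density n (\<lambda>_. 0)"
    using valid Beta by (intro cone_integral_coherent[where \<sigma> = \<sigma>]) (auto simp: \<sigma>_def)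
  then show ?thesis
    using Beta by (simp add: monom_weight_def base_density_def)
qed

section \<open>Invariance under reduction\<close>

text \<open>\<open>ennreal\<close> sends negative coefficients to 0, so additivity of
  \<open>poly_weight\<close> is claimed only on this class, which reduction preserves.\<close>

definition nonneg_poly :: "spoly \<Rightarrow> bool" where
  "nonneg_poly p \<longleftrightarrow> (\<forall>m. 0 \<le> Poly_Mapping.lookup p m)"

lemma nonneg_poly_add: "nonneg_poly p \<Longrightarrow> nonneg_poly q \<Longrightarrow> nonneg_poly (p + q)"
  by (simp add: nonneg_poly_def lookup_add)

lemma nonneg_poly_single: "0 \<le> c \<Longrightarrow> nonneg_poly (Poly_Mapping.single m c)"
  by (simp add: nonneg_poly_def lookup_single when_def)

text \<open>Puts the weights of \<open>p\<close>, \<open>q\<close> and \<open>p + q\<close> over one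
  common index set.\<close>

lemma poly_weight_superset:
  assumes "finite K" "Poly_Mapping.keys p \<subseteq> K"
  shows "poly_weight n p =
    (\<Sum>m\<in>K. ennreal (of_int (Poly_Mapping.lookup p m)) * monom_weight n m)"
  unfolding poly_weight_def using assms
  by (intro sum.mono_neutral_left) (auto simp: in_keys_iff)

lemma poly_weight_add:
  assumes "nonneg_poly p" "nonneg_poly q"
  shows "poly_weight n (p + q) = poly_weight n p + poly_weight n q"
proof -
  let ?K = "Poly_Mapping.keys p \<union> Poly_Mapping.keys q"
  have "Poly_Mapping.keys (p + q) \<subseteq> ?K" by (rule keys_add)
  then show ?thesis
    using assms
    by (simp add: poly_weight_superset[of ?K] lookup_add nonneg_poly_def
        distrib_right sum.distrib)
qed

lemma poly_weight_single: "poly_weight n (Poly_Mapping.single m 1) = monom_weight n m"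
  by (simp add: poly_weight_def)

text \<open>The six rules share one shape. For instance, in the third (e_i - e_k) + (e_j + e_k) =
  e_i + e_j, and in the fifth (e_i + e_j) + (e_i - e_j) = 2 e_i.\<close>

lemma reduction_rule_root:
  assumes "reduction_rule n u v r"
  shows "\<exists>w. valid_var n w \<and> w \<noteq> Beta \<and> u \<noteq> Beta \<and> v \<noteq> Beta \<and>
    root_of w = (\<lambda>k. root_of u k + root_of v k) \<and>
    r = var w * var u + var w * var v + var Beta * var w"
  using assms
proof cases
  case (1 i j k)
  then show ?thesis by (intro exI[of _ "X i k"]) (auto simp: fun_eq_iff algebra_simps)
next
  case (2 i j k)
  then show ?thesis by (intro exI[of _ "Y i k"]) (auto simp: fun_eq_iff algebra_simps)
next
  case (3 i j k)
  then show ?thesis by (intro exI[of _ "Y i j"]) (auto simp: fun_eq_iff algebra_simps)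
next
  case (4 i j k)
  then show ?thesis by (intro exI[of _ "Y i j"]) (auto simp: fun_eq_iff algebra_simps)
next
  case (5 i j)
  then show ?thesis by (intro exI[of _ "Z i"]) (auto simp: fun_eq_iff algebra_simps)
next
  case (6 i j)
  then show ?thesis by (intro exI[of _ "Y i j"]) (auto simp: fun_eq_iff algebra_simps)
qed

definition valid_poly :: "nat \<Rightarrow> spoly \<Rightarrow> bool" where
  "valid_poly n p \<longleftrightarrow>
     nonneg_poly p \<and> (\<forall>m\<in>Poly_Mapping.keys p. \<forall>v\<in>Poly_Mapping.keys m. valid_var n v)"

lemma valid_poly_add: "valid_poly n p \<Longrightarrow> valid_poly n q \<Longrightarrow> valid_poly n (p + q)"
  using keys_add[of p q] by (auto simp: valid_poly_def nonneg_poly_add)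

text \<open>Split off the rewritten occurrence: \<open>p\<close> is \<open>p0\<close> plus one
  monomial and \<open>q\<close> is \<open>p0 + s\<close>. All parts are nonnegative, so weights add,
  and \<open>monom_weight_split\<close> equates the weights of the monomial and of
  \<open>s\<close>.\<close>

lemma reduction_step_weight:
  assumes "reduction_step n p q" "valid_poly n p"
  shows "valid_poly n q \<and> poly_weight n q = poly_weight n p"
  using assms(1)
proof cases
  case (1 u v r m)
  let ?S = "\<lambda>m. Poly_Mapping.single m (1 :: int)"
  let ?m = "monom_of u + monom_of v + m"
  define p0 where "p0 = p - ?S ?m"
  from reduction_rule_root[OF 1(2)] obtain w where w: "valid_var n w" "w \<noteq> Beta" "u \<noteq> Beta"
    "v \<noteq> Beta" "root_of w = (\<lambda>k. root_of u k + root_of v k)"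
    and r: "r = var w * var u + var w * var v + var Beta * var w" by blast
  define s where "s = ?S (monom_of w + monom_of u + m) + ?S (monom_of w + monom_of v + m) +
    ?S (monom_of Beta + monom_of w + m)"
  have "r * ?S m = s"
    unfolding r s_def var_def distrib_right mult_single by simp
  then have q: "q = p0 + s"
    unfolding 1(1) p0_def by (rule arg_cong)
  \<comment> \<open>The coefficient is a positive integer, so removing one occurrence leaves
    \<open>p0\<close> nonnegative.\<close>
  have pos: "0 < Poly_Mapping.lookup p ?m"
  proof -
    have "0 \<le> Poly_Mapping.lookup p ?m" "Poly_Mapping.lookup p ?m \<noteq> 0"
      using assms(2) 1(3) unfolding valid_poly_def nonneg_poly_def in_keys_iff by blast+
    then show ?thesis by linarith
  qed
  have p0: "nonneg_poly p0"
    unfolding nonneg_poly_def p0_def lookup_minus lookup_single when_def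
    using assms(2) pos by (simp add: valid_poly_def nonneg_poly_def)
  have keys_p0: "Poly_Mapping.keys p0 \<subseteq> Poly_Mapping.keys p"
  proof
    fix m' assume "m' \<in> Poly_Mapping.keys p0"
    then show "m' \<in> Poly_Mapping.keys p"
      using 1(3) unfolding p0_def by (cases "?m = m'")
        (simp_all add: in_keys_iff lookup_minus lookup_single when_def)
  qed
  have "\<forall>v\<in>Poly_Mapping.keys ?m. valid_var n v"
    using assms(2) 1(3) by (auto simp: valid_poly_def)
  then have "valid_poly n s"
    unfolding s_def using w(1)
    by (intro valid_poly_add)
      (auto simp: valid_poly_def nonneg_poly_single keys_monom_add keys_monom_of)
  moreover have "valid_poly n p0"
    using assms(2) p0 keys_p0 by (auto simp: valid_poly_def)
  moreover have "poly_weight n s = monom_weight n ?m"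
  proof -
    have "poly_weight n s = monom_weight n (monom_of w + monom_of u + m) +
        monom_weight n (monom_of w + monom_of v + m) +
        monom_weight n (monom_of Beta + monom_of w + m)"
      by (simp add: s_def poly_weight_add nonneg_poly_add nonneg_poly_single poly_weight_single)
    also have "monom_weight n (monom_of Beta + monom_of w + m) = 0"
      by (simp add: monom_weight_def keys_monom_add keys_monom_of)
    finally show ?thesis
      by (simp add: monom_weight_split[OF w(5,3,4,2)])
  qed
  moreover have "poly_weight n p = poly_weight n p0 + monom_weight n ?m"
    using poly_weight_add[OF p0 nonneg_poly_single[of 1 ?m]]
    by (simp add: p0_def poly_weight_single)
  ultimately show ?thesis
    unfolding q using poly_weight_add[OF p0, of s] valid_poly_add[of n p0 s]
    by (simp add: valid_poly_def)
qed

lemma reduction_steps_weight: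
  assumes "(reduction_step n)\<^sup>*\<^sup>* p q" "valid_poly n p"
  shows "valid_poly n q \<and> poly_weight n q = poly_weight n p"
  using assms by (induction rule: rtranclp_induct) (auto dest: reduction_step_weight)

section \<open>Evaluation of irreducible polynomials\<close>

lemma eval_ones_beta_zero:
  "eval_spoly ones_beta_zero p =
    (\<Sum>m\<in>Poly_Mapping.keys p. Poly_Mapping.lookup p m * (if Beta \<in> Poly_Mapping.keys m then 0 else 1))"
  unfolding eval_spoly_def
proof (intro sum.cong refl arg_cong2[where f = "(*)"])
  fix m :: smonom
  show "(\<Prod>v\<in>Poly_Mapping.keys m. ones_beta_zero v ^ Poly_Mapping.lookup m v) =
      (if Beta \<in> Poly_Mapping.keys m then 0 else 1)"
  proof (cases "Beta \<in> Poly_Mapping.keys m")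
    case True
    then have "\<exists>v\<in>Poly_Mapping.keys m. ones_beta_zero v ^ Poly_Mapping.lookup m v = 0"
      by (intro bexI[of _ Beta]) (auto simp: ones_beta_zero_def in_keys_iff)
    with True show ?thesis by simp
  next
    case False
    then show ?thesis
      by (auto intro!: prod.neutral simp: ones_beta_zero_def)
  qed
qed

text \<open>Each monomial without \<open>Beta\<close> has weight 1 and each with \<open>Beta\<close>
  has weight 0, exactly as under evaluation. Nonnegativity of the value is recorded so that it can
  be recovered from its image in \<open>ennreal\<close>.\<close>

lemma poly_weight_irreducible:
  assumes p: "valid_poly n p" and irred: "\<nexists>q. reduction_step n p q"
  shows "0 \<le> eval_spoly ones_beta_zero p"
    and "poly_weight n p = ennreal (of_int (eval_spoly ones_beta_zero p))"
proof -
  have nonneg: "0 \<le> Poly_Mapping.lookup p m" for m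
    using p by (auto simp: valid_poly_def nonneg_poly_def)
  then show "0 \<le> eval_spoly ones_beta_zero p"
    unfolding eval_ones_beta_zero by (auto intro!: sum_nonneg)
  have "monom_weight n m = (if Beta \<in> Poly_Mapping.keys m then 0 else 1)"
    if m: "m \<in> Poly_Mapping.keys p" for m
  proof (cases "Beta \<in> Poly_Mapping.keys m")
    case False
    have "monom_weight n m = 1"
    proof (rule monom_weight_irreducible[OF _ _ False])
      show "m \<noteq> monom_of u + monom_of v + m'" if "reduction_rule n u v r" for u v r m'
        \<comment> \<open>A factor matching a left-hand side would give a reduction step of the
          whole polynomial.\<close>
        using reduction_step.intros[OF that, of m' p] m irred by blast
    qed (use m p in \<open>auto simp: valid_poly_def\<close>)
    with False show ?thesis by simp
  qed (simp add: monom_weight_def)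
  then have "poly_weight n p = (\<Sum>m\<in>Poly_Mapping.keys p.
      ennreal (of_int (Poly_Mapping.lookup p m * (if Beta \<in> Poly_Mapping.keys m then 0 else 1))))"
    unfolding poly_weight_def by (intro sum.cong) auto
  also have "\<dots> = ennreal (of_int (eval_spoly ones_beta_zero p))"
    unfolding eval_ones_beta_zero using nonneg by (subst sum_ennreal) auto
  finally show "poly_weight n p = ennreal (of_int (eval_spoly ones_beta_zero p))" .
qed

section \<open>The graph monomial and the conclusion\<close>

lemma valid_edge_var:
  assumes "valid_edge n e"
  shows "valid_var n (edge_var e)"
proof -
  obtain i j s where e: "e = (i, j, s)" by (cases e)
  show ?thesis using assms unfolding e by (cases s) auto
qed

lemma valid_graph_monomial:
  assumes "is_signed_graph n G"
  shows "valid_poly n (graph_monomial G)"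
proof -
  \<comment> \<open>The product is a single monomial with coefficient 1; arbitrary finite subsets of
    the edges allow induction.\<close>
  have "\<exists>m. (\<Prod>e\<in>E. var (edge_var (label G e))) = Poly_Mapping.single m 1 \<and>
      (\<forall>v\<in>Poly_Mapping.keys m. valid_var n v)" if "finite E" "E \<subseteq> edges G" for E
    using that
  proof (induction E)
    case empty
    show ?case by (intro exI[of _ 0]) simp
  next
    case (insert e E)
    then obtain m where "(\<Prod>e\<in>E. var (edge_var (label G e))) = Poly_Mapping.single m 1"
        "\<forall>v\<in>Poly_Mapping.keys m. valid_var n v" by auto
    moreover have "valid_var n (edge_var (label G e))"
      using assms insert.prems by (auto simp: is_signed_graph_def valid_edge_var)
    ultimately show ?case
      using insert.hyps
      by (intro exI[of _ "monom_of (edge_var (label G e)) + m"])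
        (auto simp: var_def mult_single keys_monom_add keys_monom_of)
  qed
  from this[of "edges G"] show ?thesis
    using assms
    by (auto simp: is_signed_graph_def graph_monomial_def valid_poly_def nonneg_poly_single)
qed

theorem corollary13:
  fixes n :: nat and G0 :: "'e signed_graph" and P Q :: spoly
  assumes "G0 \<in> indep_signed_graphs n"
    and "reduced_form n (graph_monomial G0) P"
    and "reduced_form n (graph_monomial G0) Q"
  shows "eval_spoly ones_beta_zero P = eval_spoly ones_beta_zero Q"
proof -
  have G0: "valid_poly n (graph_monomial G0)"
    using assms(1) by (intro valid_graph_monomial) (simp add: indep_signed_graphs_def)
  have weight: "0 \<le> eval_spoly ones_beta_zero R \<and>
      poly_weight n (graph_monomial G0) = ennreal (of_int (eval_spoly ones_beta_zero R))"
    if "reduced_form n (graph_monomial G0) R" for R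
    using that reduction_steps_weight[OF _ G0, of R] poly_weight_irreducible[of n R]
    by (auto simp: reduced_form_def)
  show ?thesis
    \<comment> \<open>Both values have the same image in \<open>ennreal\<close>, which is injective
      on nonnegative reals.\<close>
    using weight[OF assms(2)] weight[OF assms(3)] by auto
qed

end
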